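(* Let $N\ge1$, $p\ge0$, $K\ge1$ and $k_1,\dots,k_K$ be integers with $p<k_1\leqslant k_2\leqslant\cdots\leqslant k_K<N$, let $x^{k_i}\in L_{k_i}$ for $1\le i\le K$, and let $f:\{0,1\}^N\to\{0,1\}$ be a monotone Boolean function that is $K$-ideal with respect to $\{x^{k_i}\}_{i=1}^K$. Then for all $j_1,\dots,j_K\in\{0,1\}$ such that $\mathcal S_{j_1j_2\cdots j_K}\neq\emptyset$, $$2^N\hat f(\mathcal S_{j_1j_2\cdots j_K})=\binom{N-1}{p}+\sum_{\substack{1\leqslant i\leqslant K\\ j_i=0}}\ \sum_{l=p+1}^{k_i}\binom{k_i}{l}-\sum_{\substack{1\leqslant i\leqslant K\\ j_i=1}}\binom{k_i-1}{p},$$ where $\hat f(\mathcal S_{j_1j_2\cdots j_K})$ denotes the influence $\hat f(j)$ of an arbitrary $j\in\mathcal S_{j_1j_2\cdots j_K}$ (the formula holds for every such $j$).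
   Context: $\{0,1\}^N$ carries the componentwise partial order; $f:\{0,1\}^N\to\{0,1\}$ is monotone if $x\le y$ implies $f(x)\le f(y)$. $\|x\|_1$ is the number of ones in $x$; $L_k=\{x\in\{0,1\}^N:\|x\|_1=k\}$ and $L_{\leqslant k}=\{x:\|x\|_1\leqslant k\}$. For $x\in L_k$ with $k>p$, the Boolean sub-cube $\mathcal B_{x}$ determined by $x$ is the set of all $y\le x$ with $p+1\le\|y\|_1\le k$. $\Delta$ is the Hamming distance, $\Delta(x,y)=\#\{i:x_i\neq y_i\}$, and for sets $\Delta(A,B)=\min_{a\in A,b\in B}\Delta(a,b)$. An upper zero of $f$ is a point $x$ with $f(x)=0$ and $f(y)=1$ for every $y>x$. $K$-ideal: let $x^{k_i}\in L_{k_i}$ ($1\le i\le K$) be upper zeros of a monotone Boolean function $f$, with $p<k_1\le\cdots\le k_K<N$. Then $f$ is called $K$-ideal with respect to $\{x^{k_i}\}_{i=1}^K$ if (1) $\Delta(\mathcal B_{x^{k_i}}\setminus L_{\leqslant p},\ \mathcal B_{x^{k_j}}\setminus L_{\leqslant p})>0$ for all $i\ne j$, $1\le i,j\le K$ (the sub-cubes are pairwise disjoint above level $p$), and (2) $f(x)=0$ for all $x\in\bigcup_{i=1}^K\mathcal B_{x^{k_i}}\cup L_{\leqslant p}$ and $f(x)=1$ for all other $x$. For $l\in\{0,1\}$ put $\mathcal S^{l}_{x^{k_i}}=\{j\in\{1,\dots,N\}:x^{k_i}_j=l\}$, and $\mathcal S_{j_1j_2\cdots j_K}=\bigcap_{i=1}^K\mathcal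 S^{j_i}_{x^{k_i}}$ for $j_1,\dots,j_K\in\{0,1\}$. Influence: for $i\in\{1,\dots,N\}$, $\hat f(i)=2^{-N}\sum_{x\in\{0,1\}^N}f(x)(-1)^{1+x_i}$. For monotone $f$, $2^N\hat f(i)$ is the number of $x\in\{0,1\}^N$ with $x_i=0$, $f(x)=0$ and $f(x+e_i)=1$, where $x+e_i$ is $x$ with the $i$-th bit changed to $1$. Binomial coefficients $\binom{a}{b}$ are $0$ if $b>a$. *)

theory Defs
  imports Complex_Main "HOL-Library.Cardinality"
begin

text \<open>The cube with \<open>N = CARD('n)\<close> coordinates is the type \<^typ>\<open>'n \<Rightarrow> bool\<close> for a finite index
  type, where \<^term>\<open>False\<close> is 0 and \<^term>\<open>True\<close> is 1.  The library order on this function type is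
  the componentwise order, and monotonicity of a Boolean function is the library's \<^const>\<open>mono\<close>.\<close>

definition ones :: "('n::finite \<Rightarrow> bool) \<Rightarrow> nat" where
  "ones x = card {i. x i}"

definition level :: "nat \<Rightarrow> ('n::finite \<Rightarrow> bool) set" where
  "level k = {x. ones x = k}"

definition levels_upto :: "nat \<Rightarrow> ('n::finite \<Rightarrow> bool) set" where
  "levels_upto k = {x. ones x \<le> k}"

text \<open>The top level of the sub-cube is the level of \<open>x\<close> itself, so only \<open>p\<close> is a parameter.\<close>

definition subcube :: "nat \<Rightarrow> ('n::finite \<Rightarrow> bool) \<Rightarrow> ('n \<Rightarrow> bool) set" where
  "subcube p x = {y. y \<le> x \<and> p + 1 \<le> ones y \<and> ones y \<le> ones x}"

definition hamming :: "('n::finite \<Rightarrow> bool) \<Rightarrow> ('n \<Rightarrow> bool) \<Rightarrow> nat" where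
  "hamming x y = card {i. x i \<noteq> y i}"

text \<open>Only meaningful for nonempty sets; a sub-cube \<^term>\<open>subcube p x\<close> contains \<open>x\<close> whenever
  \<^term>\<open>p < ones x\<close>.\<close>

definition hamming_set :: "('n::finite \<Rightarrow> bool) set \<Rightarrow> ('n \<Rightarrow> bool) set \<Rightarrow> nat" where
  "hamming_set A B = Min {hamming a b | a b. a \<in> A \<and> b \<in> B}"

definition upper_zero :: "(('n::finite \<Rightarrow> bool) \<Rightarrow> bool) \<Rightarrow> ('n \<Rightarrow> bool) \<Rightarrow> bool" where
  "upper_zero f x \<longleftrightarrow> \<not> f x \<and> (\<forall>y. x < y \<longrightarrow> f y)"

text \<open>The families \<open>k\<close> and \<open>x\<close> are used only at the indices \<open>1, \<dots>, K\<close>.\<close>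

definition K_ideal ::
  "nat \<Rightarrow> nat \<Rightarrow> (nat \<Rightarrow> nat) \<Rightarrow> (nat \<Rightarrow> ('n::finite \<Rightarrow> bool)) \<Rightarrow> (('n \<Rightarrow> bool) \<Rightarrow> bool) \<Rightarrow> bool" where
  "K_ideal p K k x f \<longleftrightarrow>
     mono f \<and>
     p < k 1 \<and> mono_on {1..K} k \<and> k K < CARD('n) \<and>
     (\<forall>i\<in>{1..K}. x i \<in> level (k i) \<and> upper_zero f (x i)) \<and>
     (\<forall>i\<in>{1..K}. \<forall>j\<in>{1..K}. i \<noteq> j \<longrightarrow>
        hamming_set (subcube p (x i) - levels_upto p) (subcube p (x j) - levels_upto p) > 0) \<and>
     (\<forall>y \<in> (\<Union>i\<in>{1..K}. subcube p (x i)) \<union> levels_upto p. \<not> f y) \<and>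
     (\<forall>y. y \<notin> (\<Union>i\<in>{1..K}. subcube p (x i)) \<union> levels_upto p \<longrightarrow> f y)"

definition coords :: "bool \<Rightarrow> ('n::finite \<Rightarrow> bool) \<Rightarrow> 'n set" where
  "coords l x = {j. x j = l}"

definition coord_cell :: "nat \<Rightarrow> (nat \<Rightarrow> ('n::finite \<Rightarrow> bool)) \<Rightarrow> (nat \<Rightarrow> bool) \<Rightarrow> 'n set" where
  "coord_cell K x b = (\<Inter>i\<in>{1..K}. coords (b i) (x i))"

definition influence :: "(('n::finite \<Rightarrow> bool) \<Rightarrow> bool) \<Rightarrow> 'n \<Rightarrow> real" where
  "influence f i =
     (\<Sum>x\<in>UNIV. of_bool (f x) * (-1) ^ (1 + of_bool (x i))) / 2 ^ CARD('n)"

end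

theory Submission
  imports Defs
begin

text \<open>Put \<open>t j y = 1\<close> if \<open>y j = 0\<close> and \<open>t j y = -1\<close> if \<open>y j = 1\<close>.  The sum of \<open>t j\<close> over the whole
  cube vanishes, so \<open>2^N\<close> times the influence of \<open>j\<close> is the sum of \<open>t j\<close> over the zeros of \<open>f\<close>, which
  is a disjoint union of \<open>L\<^sub>\<le>\<^sub>p\<close> and the sub-cubes.  Toggling \<open>j\<close> cancels almost all of the sum of
  \<open>t j\<close> over the points below \<open>z\<close> with at most \<open>p\<close> ones when \<open>z j = 1\<close>: only the points with
  \<open>y j = 0\<close> and exactly \<open>p\<close> ones survive.\<close>

definition toggle_sign :: "'n \<Rightarrow> ('n \<Rightarrow> bool) \<Rightarrow> real" where
  "toggle_sign j y = (if y j then -1 else 1)"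

text \<open>Both kinds of zeros reduce to this set: \<open>levels_upto p\<close> is the case of the
  all-ones point, and a sub-cube is a difference of two such sets under the same \<open>z\<close>.
  One signed count thus serves both.\<close>

definition below_upto :: "nat \<Rightarrow> ('n::finite \<Rightarrow> bool) \<Rightarrow> ('n \<Rightarrow> bool) set" where
  "below_upto p z = {y. y \<le> z \<and> ones y \<le> p}"

lemma sum_below_upto_conv_subsets:
  "sum g (below_upto p z) = (\<Sum>S | S \<subseteq> {i. z i} \<and> card S \<le> p. g (\<lambda>i. i \<in> S))"
  by (rule sum.reindex_bij_witness[where i = "\<lambda>S i. i \<in> S" and j = Collect])
     (auto simp: below_upto_def ones_def le_fun_def)

text \<open>For \<open>S\<close> inside \<open>A\<close>, the terms of \<open>S\<close> and
  \<open>insert j S\<close> cancel whenever both sets meet the size bound. A set with exactly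
  \<open>p\<close> elements has no partner, because adding \<open>j\<close> exceeds the
  bound.\<close>

lemma sum_sign_subsets_card_le:
  assumes "finite A" "j \<notin> A"
  shows "(\<Sum>S | S \<subseteq> insert j A \<and> card S \<le> p. if j \<in> S then -1 else 1 :: real) =
    real (card A choose p)"
proof -
  let ?g = "\<lambda>S. if j \<in> S then -1 else 1 :: real"
  \<comment> \<open>\<open>?Q\<close> collects the sets that still fit after \<open>j\<close> is
    added. With the bound \<open>Suc (card S) \<le> p\<close> it is empty for \<open>p = 0\<close>,
    which \<open>card S \<le> p - 1\<close> would not give.\<close>
  let ?P = "{S. S \<subseteq> A \<and> card S \<le> p}" and ?Q = "{S. S \<subseteq> A \<and> Suc (card S) \<le> p}"
  have fin: "finite ?P" "finite ?Q"
    using assms by auto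
  have card_insert': "card (insert j S) = Suc (card S)" if "S \<subseteq> A" for S
    using that assms by (metis card_insert_disjoint finite_subset subsetD)
  have split: "{S. S \<subseteq> insert j A \<and> card S \<le> p} = ?P \<union> insert j ` ?Q"
  proof (intro set_eqI iffI)
    fix S assume S: "S \<in> {S. S \<subseteq> insert j A \<and> card S \<le> p}"
    show "S \<in> ?P \<union> insert j ` ?Q"
    proof (cases "j \<in> S")
      case True
      then have S_eq: "insert j (S - {j}) = S" and sub: "S - {j} \<subseteq> A"
        using S by auto
      have "card S = Suc (card (S - {j}))"
        using card_insert'[OF sub] S_eq by simp
      then have "S - {j} \<in> ?Q"
        using S sub by auto
      then show ?thesis
        using S_eq by blast
    qed (use S in auto)
  qed (auto simp: card_insert')
  have "inj_on (insert j) ?Q"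
    using assms by (auto simp: inj_on_def)
  then have neg: "sum ?g (insert j ` ?Q) = - real (card ?Q)"
    by (simp add: sum.reindex)
  have pos: "sum ?g ?P = real (card ?P)"
    using assms by (subst sum.cong[OF refl, of _ _ "\<lambda>_. 1"]) auto
  have "?P = ?Q \<union> {S. S \<subseteq> A \<and> card S = p}"
    by auto
  then have "card ?P = card ?Q + (card A choose p)"
    using assms fin by (simp add: card_Un_disjoint disjoint_iff n_subsets)
  moreover have "sum ?g (?P \<union> insert j ` ?Q) = sum ?g ?P + sum ?g (insert j ` ?Q)"
    using fin assms by (intro sum.union_disjoint) auto
  ultimately show ?thesis
    unfolding split by (simp only: pos neg)
qed

lemma sum_toggle_sign_below_upto:
  assumes "z j"
  shows "sum (toggle_sign j) (below_upto p z) = real ((ones z - 1) choose p)"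
proof -
  have "insert j ({i. z i} - {j}) = {i. z i}"
    using assms by auto
  moreover have "sum (toggle_sign j) (below_upto p z) =
      (\<Sum>S | S \<subseteq> {i. z i} \<and> card S \<le> p. if j \<in> S then -1 else 1)"
    by (simp only: sum_below_upto_conv_subsets toggle_sign_def)
  moreover have "card ({i. z i} - {j}) = ones z - 1"
    using assms by (simp add: ones_def)
  ultimately show ?thesis
    using sum_sign_subsets_card_le[of "{i. z i} - {j}" j p] by simp
qed

lemma subcube_conv_Diff: "subcube p z = below_upto (ones z) z - below_upto p z"
  by (auto simp: subcube_def below_upto_def)

lemma levels_upto_conv_below_upto: "levels_upto p = below_upto p (\<lambda>_. True)"
  by (auto simp: levels_upto_def below_upto_def le_fun_def)

lemma ones_True: "ones (\<lambda>_ :: 'n::finite. True) = CARD('n)"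
  by (simp add: ones_def)

text \<open>The cube is the case \<open>p = CARD('n)\<close> of the signed count at the all-ones
  point, and choosing \<open>CARD('n)\<close> out of \<open>CARD('n) - 1\<close> gives 0.\<close>

lemma sum_toggle_sign_UNIV: "sum (toggle_sign (j :: 'n::finite)) UNIV = 0"
proof -
  have "UNIV = below_upto CARD('n) (\<lambda>_ :: 'n. True)"
    by (auto simp: below_upto_def ones_def le_fun_def intro: card_mono)
  then show ?thesis
    using sum_toggle_sign_below_upto[of "\<lambda>_. True" j "CARD('n)"]
    by (simp add: ones_True binomial_eq_0)
qed

text \<open>The full set of points below \<open>z\<close> has signed sum 0, as
  \<open>ones z - 1\<close> choose \<open>ones z\<close> vanishes for \<open>ones z > 0\<close>.
  What remains is minus the sum over the part cut off at level \<open>p\<close>.\<close>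

lemma sum_toggle_sign_subcube_one:
  assumes "z j" "p < ones z"
  shows "sum (toggle_sign j) (subcube p z) = - real ((ones z - 1) choose p)"
proof -
  have "below_upto p z \<subseteq> below_upto (ones z) z"
    using assms by (auto simp: below_upto_def)
  then have "sum (toggle_sign j) (subcube p z) =
      sum (toggle_sign j) (below_upto (ones z) z) - sum (toggle_sign j) (below_upto p z)"
    unfolding subcube_conv_Diff by (intro sum_diff) auto
  then show ?thesis
    using assms by (simp add: sum_toggle_sign_below_upto binomial_eq_0)
qed

lemma card_subcube: "card (subcube p z) = (\<Sum>l = p + 1..ones z. ones z choose l)"
proof -
  have eq: "subcube p z = (\<Union>l\<in>{p + 1..ones z}. {y. y \<le> z \<and> ones y = l})"
    by (auto simp: subcube_def)
  have "card {y. y \<le> z \<and> ones y = l} = ones z choose l" for l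
  proof -
    have "bij_betw Collect {y. y \<le> z \<and> ones y = l} {S. S \<subseteq> {i. z i} \<and> card S = l}"
      by (rule bij_betw_byWitness[where f' = "\<lambda>S i. i \<in> S"]) (auto simp: ones_def le_fun_def)
    then show ?thesis
      by (simp add: bij_betw_same_card n_subsets ones_def)
  qed
  then show ?thesis
    unfolding eq by (subst card_UN_disjoint) auto
qed

text \<open>Every point below \<open>z\<close> inherits the zero in coordinate \<open>j\<close>, so
  nothing cancels and the sum is the size of the sub-cube.\<close>

lemma sum_toggle_sign_subcube_zero:
  assumes "\<not> z j"
  shows "sum (toggle_sign j) (subcube p z) = (\<Sum>l = p + 1..ones z. real (ones z choose l))"
proof -
  have "toggle_sign j y = 1" if "y \<in> subcube p z" for y
    using that assms by (auto simp: subcube_def toggle_sign_def le_fun_def)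
  then show ?thesis
    by (simp add: card_subcube)
qed

lemma influence_conv_sum_zeros:
  fixes f :: "('n::finite \<Rightarrow> bool) \<Rightarrow> bool"
  shows "2 ^ CARD('n) * influence f j = sum (toggle_sign j) {y. \<not> f y}"
proof -
  have "2 ^ CARD('n) * influence f j = (\<Sum>y\<in>UNIV. - (of_bool (f y) * toggle_sign j y))"
    unfolding influence_def by (auto simp: toggle_sign_def intro!: sum.cong)
  \<comment> \<open>Passing from \<open>f\<close> to its complement costs one copy of
    \<open>toggle_sign j y\<close> at each point, and these add up to 0 over the cube.\<close>
  also have "\<dots> = (\<Sum>y\<in>UNIV. of_bool (\<not> f y) * toggle_sign j y - toggle_sign j y)"
    by (intro sum.cong) auto
  also have "\<dots> = (\<Sum>y\<in>UNIV. of_bool (\<not> f y) * toggle_sign j y)"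
    by (simp add: sum_subtractf sum_toggle_sign_UNIV)
  also have "\<dots> = sum (toggle_sign j) {y. \<not> f y}"
    by (rule sum.mono_neutral_cong_right) auto
  finally show ?thesis .
qed

text \<open>A common point puts the distance 0 into the finite set whose minimum is taken.\<close>

lemma disjoint_if_hamming_set_pos:
  fixes A B :: "('n::finite \<Rightarrow> bool) set"
  assumes "hamming_set A B > 0"
  shows "A \<inter> B = {}"
proof (rule ccontr)
  assume "A \<inter> B \<noteq> {}"
  then obtain z where "z \<in> A" "z \<in> B"
    by auto
  then have "hamming z z \<in> {hamming a b | a b. a \<in> A \<and> b \<in> B}"
    by blast
  moreover have "finite {hamming a b | a b. a \<in> A \<and> b \<in> B}"
    by (rule finite_subset[of _ "(\<lambda>(a, b). hamming a b) ` (A \<times> B)"]) auto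
  ultimately have "hamming_set A B \<le> hamming z z"
    unfolding hamming_set_def by (intro Min_le)
  then show False
    using assms by (simp add: hamming_def)
qed

theorem theorem3:
  fixes p K :: nat
    and k :: "nat \<Rightarrow> nat"
    and x :: "nat \<Rightarrow> ('n::finite \<Rightarrow> bool)"
    and f :: "('n \<Rightarrow> bool) \<Rightarrow> bool"
  assumes "1 \<le> K"
    and "p < k 1" and "mono_on {1..K} k" and "k K < CARD('n)"
    and "\<And>i. i \<in> {1..K} \<Longrightarrow> x i \<in> level (k i)"
    and "mono f"
    and "K_ideal p K k x f"
  shows "\<forall>b :: nat \<Rightarrow> bool. coord_cell K x b \<noteq> {} \<longrightarrow>
    (\<forall>j \<in> coord_cell K x b.
       2 ^ CARD('n) * influence f j =
         real ((CARD('n) - 1) choose p)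
         + (\<Sum>i | i \<in> {1..K} \<and> \<not> b i. \<Sum>l = p + 1..k i. real (k i choose l))
         - (\<Sum>i | i \<in> {1..K} \<and> b i. real ((k i - 1) choose p)))"
proof (intro allI impI ballI)
  fix b :: "nat \<Rightarrow> bool" and j
  assume "j \<in> coord_cell K x b"
  then have xj: "x i j = b i" if "i \<in> {1..K}" for i
    using that by (auto simp: coord_cell_def coords_def)
  have ones_x: "ones (x i) = k i" if "i \<in> {1..K}" for i
    using assms(5)[OF that] by (simp add: level_def)
  have p_less: "p < k i" if "i \<in> {1..K}" for i
    using that assms(2) mono_onD[OF assms(3), of 1 i] by auto
  let ?t = "toggle_sign j"
  have zeros: "{y. \<not> f y} = levels_upto p \<union> (\<Union>i\<in>{1..K}. subcube p (x i))"
    using assms(7) unfolding K_ideal_def by blast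
  have subcube_Diff: "subcube p z - levels_upto p = subcube p z" for z :: "'n \<Rightarrow> bool"
    by (auto simp: subcube_def levels_upto_def)
  have disj: "subcube p (x i) \<inter> subcube p (x i') = {}"
    if "i \<in> {1..K}" "i' \<in> {1..K}" "i \<noteq> i'" for i i'
  proof (rule disjoint_if_hamming_set_pos)
    have "\<forall>i\<in>{1..K}. \<forall>j\<in>{1..K}. i \<noteq> j \<longrightarrow>
        hamming_set (subcube p (x i)) (subcube p (x j)) > 0"
      using assms(7) unfolding K_ideal_def subcube_Diff by (elim conjE)
    then show "hamming_set (subcube p (x i)) (subcube p (x i')) > 0"
      using that by simp
  qed
  \<comment> \<open>Sub-cubes start at level \<open>p + 1\<close>, so they do not meet
    \<open>levels_upto p\<close>.\<close>
  have "sum ?t {y. \<not> f y} = sum ?t (levels_upto p) + sum ?t (\<Union>i\<in>{1..K}. subcube p (x i))"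
    unfolding zeros by (rule sum.union_disjoint) (auto simp: levels_upto_def subcube_def)
  also have "sum ?t (levels_upto p) = real ((CARD('n) - 1) choose p)"
    by (simp add: levels_upto_conv_below_upto sum_toggle_sign_below_upto ones_True)
  also have "sum ?t (\<Union>i\<in>{1..K}. subcube p (x i)) = (\<Sum>i\<in>{1..K}. sum ?t (subcube p (x i)))"
    using disj by (intro sum.UNION_disjoint) auto
  \<comment> \<open>Membership of \<open>j\<close> in the cell makes \<open>b i\<close> the bit of
    \<open>x i\<close> at \<open>j\<close>, which decides between the two sub-cube sums.\<close>
  also have "\<dots> = (\<Sum>i\<in>{1..K}. if b i then - real ((k i - 1) choose p)
      else (\<Sum>l = p + 1..k i. real (k i choose l)))"
    using xj ones_x p_less
    by (intro sum.cong)
       (auto simp: sum_toggle_sign_subcube_one sum_toggle_sign_subcube_zero)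
  also have "\<dots> = (\<Sum>i | i \<in> {1..K} \<and> \<not> b i. \<Sum>l = p + 1..k i. real (k i choose l))
      - (\<Sum>i | i \<in> {1..K} \<and> b i. real ((k i - 1) choose p))"
    by (simp add: sum.If_cases Int_def sum_negf)
  finally show "2 ^ CARD('n) * influence f j =
      real ((CARD('n) - 1) choose p)
      + (\<Sum>i | i \<in> {1..K} \<and> \<not> b i. \<Sum>l = p + 1..k i. real (k i choose l))
      - (\<Sum>i | i \<in> {1..K} \<and> b i. real ((k i - 1) choose p))"
    by (simp add: influence_conv_sum_zeros)
qed

end
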